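(* Let $H$ be a connected bipartite graph of order $n_2$ and let $G$ be a non-trivial connected graph of order $n_1$, having $t_1$ true twin equivalence classes. If $\dim_l(G)=n_1-t_1$ and $D(G)<r(H)$, then $\dim_l(G\boxtimes H)= n_2(n_1-t_1)$.
   Context: $D(G)$ is the diameter of $G$ and $r(H)$ the radius of $H$. Two vertices $u,v$ are true twins if $N_G[u]=N_G[v]$; the true twin equivalence classes are the classes of the relation $N_G[x]=N_G[y]$. A set $S$ is a local metric generator for a connected graph $G$ if for every two adjacent vertices $x,y$ there is $s\in S$ with $d_G(s,x)\ne d_G(s,y)$; $\dim_l(G)$ is the minimum cardinality of a local metric generator. The strong product $G\boxtimes H$ has vertex set $V(G)\times V(H)$, with $(a,b)\sim(c,d)$ iff ($a=c$ and $b\sim d$) or ($b=d$ and $a\sim c$) or ($a\sim c$ and $b\sim d$). *)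

theory Defs
  imports "Graph_Theory.Graph_Theory"
begin

text \<open>
  Finite simple graphs are \<open>pair_graph\<close>s: each undirected edge is represented by the two arcs
  \<open>(u, v)\<close> and \<open>(v, u)\<close>.
  The distance is the shortest-path cost with every arc costing 1. It is \<open>ereal\<close>-valued, so it
  is infinite between different components; on a finite connected graph, every supremum and
  infimum below is attained and finite.
\<close>

definition gdist :: "'a pair_pre_digraph \<Rightarrow> 'a \<Rightarrow> 'a \<Rightarrow> ereal" where
  "gdist G u v = wf_digraph.\<mu> (with_proj G) (\<lambda>_. 1) u v"

definition eccentricity :: "'a pair_pre_digraph \<Rightarrow> 'a \<Rightarrow> ereal" where
  "eccentricity G u = (SUP v\<in>pverts G. gdist G u v)"

definition diameter :: "'a pair_pre_digraph \<Rightarrow> ereal" where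
  "diameter G = (SUP u\<in>pverts G. eccentricity G u)"

definition radius :: "'a pair_pre_digraph \<Rightarrow> ereal" where
  "radius G = (INF u\<in>pverts G. eccentricity G u)"

definition bipartite :: "'a pair_pre_digraph \<Rightarrow> bool" where
  "bipartite G \<longleftrightarrow> (\<exists>A B. A \<union> B = pverts G \<and> A \<inter> B = {} \<and>
     (\<forall>(u, v)\<in>parcs G. u \<in> A \<and> v \<in> B \<or> u \<in> B \<and> v \<in> A))"

definition closed_nbhd :: "'a pair_pre_digraph \<Rightarrow> 'a \<Rightarrow> 'a set" where
  "closed_nbhd G u = insert u {v. (u, v) \<in> parcs G}"

definition true_twins :: "'a pair_pre_digraph \<Rightarrow> 'a rel" where
  "true_twins G = {(u, v). u \<in> pverts G \<and> v \<in> pverts G \<and> closed_nbhd G u = closed_nbhd G v}"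

definition true_twin_classes :: "'a pair_pre_digraph \<Rightarrow> 'a set set" where
  "true_twin_classes G = pverts G // true_twins G"

definition local_metric_generator :: "'a pair_pre_digraph \<Rightarrow> 'a set \<Rightarrow> bool" where
  "local_metric_generator G S \<longleftrightarrow> S \<subseteq> pverts G \<and>
     (\<forall>(x, y)\<in>parcs G. \<exists>s\<in>S. gdist G s x \<noteq> gdist G s y)"

definition local_metric_dim :: "'a pair_pre_digraph \<Rightarrow> nat" where
  "local_metric_dim G = (LEAST k. \<exists>S. local_metric_generator G S \<and> card S = k)"

definition strong_product ::
    "'a pair_pre_digraph \<Rightarrow> 'b pair_pre_digraph \<Rightarrow> ('a \<times> 'b) pair_pre_digraph"
    (infixr \<open>\<boxtimes>\<close> 70) where
  "G \<boxtimes> H = \<lparr> pverts = pverts G \<times> pverts H,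
     parcs = {((a, b), (c, d)). (a, b) \<in> pverts G \<times> pverts H \<and> (c, d) \<in> pverts G \<times> pverts H \<and>
       (a = c \<and> (b, d) \<in> parcs H \<or>
        b = d \<and> (a, c) \<in> parcs G \<or>
        (a, c) \<in> parcs G \<and> (b, d) \<in> parcs H)} \<rparr>"

lemma pair_graph_strong_product:
  assumes "pair_graph G" "pair_graph H"
  shows "pair_graph (G \<boxtimes> H)"
proof -
  interpret G: pair_graph G by fact
  interpret H: pair_graph H by fact
  have "parcs (G \<boxtimes> H) \<subseteq> (pverts G \<times> pverts H) \<times> (pverts G \<times> pverts H)"
    by (auto simp: strong_product_def)
  then have "finite (parcs (G \<boxtimes> H))"
    by (rule finite_subset) simp
  moreover have "sym (parcs (G \<boxtimes> H))"
    using G.sym_arcs H.sym_arcs by (auto simp: symmetric_def strong_product_def sym_def)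
  ultimately show ?thesis
    by unfold_locales
      (auto simp: strong_product_def symmetric_def dest: G.no_loops' H.no_loops')
qed

end

theory Submission
  imports Defs
begin

text \<open>
  Lower bound: if \<open>a\<close> and \<open>c\<close> are true twins of \<open>G\<close>, then \<open>(a, h)\<close> and \<open>(c, h)\<close> are true twins of
  \<open>G \<boxtimes> H\<close>, and a local metric generator misses at most one vertex of every true twin class. So
  each of the \<open>n\<^sub>2\<close> copies of \<open>G\<close> contains at least \<open>n\<^sub>1 - t\<^sub>1\<close> vertices of the generator.

  Upper bound: let \<open>W\<close> be a local metric basis of \<open>G\<close>; then \<open>W \<times> V(H)\<close> is a local metric generator.
  Distances in \<open>G \<boxtimes> H\<close> are maxima of distances in the factors. Two adjacent vertices in the same
  copy of \<open>G\<close> are therefore resolved inside that copy. If \<open>(a, b)\<close> and \<open>(c, d)\<close> are adjacent and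
  \<open>b \<noteq> d\<close>, choose \<open>h\<close> with \<open>d(h, b) > D(G)\<close>. As \<open>H\<close> is bipartite, \<open>d(h, d)\<close> differs from \<open>d(h, b)\<close>
  by exactly one, so both are at least \<open>D(G)\<close>, both maxima are attained in the second
  coordinate, and any \<open>(w, h)\<close> with \<open>w \<in> W\<close> resolves the pair.
\<close>

section \<open>Distances as natural numbers\<close>

text \<open>Reflexivity of the step relation makes its \<open>n\<close>-th power the relation ``at distance at most
  \<open>n\<close>''.\<close>

abbreviation nearby :: "'a pair_pre_digraph \<Rightarrow> nat \<Rightarrow> 'a rel" where
  "nearby G n \<equiv> (parcs G)\<^sup>= ^^ n"

text \<open>A natural-number distance, so that parity and linear arithmetic apply. It is meaningful
  only if some power relates \<open>u\<close> to \<open>v\<close>, hence the \<open>nearby\<close>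
  hypotheses below.\<close>

definition hops :: "'a pair_pre_digraph \<Rightarrow> 'a \<Rightarrow> 'a \<Rightarrow> nat" where
  "hops G u v = (LEAST n. (u, v) \<in> nearby G n)"

lemma nearby_Suc_iff:
  "(u, v) \<in> nearby G (Suc n) \<longleftrightarrow> (\<exists>w. (u, w) \<in> (parcs G)\<^sup>= \<and> (w, v) \<in> nearby G n)"
  by (meson relpow_Suc_D2 relpow_Suc_I2)

lemma nearby_mono: "(u, v) \<in> nearby G m \<Longrightarrow> m \<le> n \<Longrightarrow> (u, v) \<in> nearby G n"
  by (induction n) (auto simp: le_Suc_eq)

text \<open>The powers increase with the exponent, so the least exponent decides membership in all
  of them; \<open>m\<close> only witnesses that one exists.\<close>

lemma hops_le_iff:
  assumes "(u, v) \<in> nearby G m"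
  shows "hops G u v \<le> n \<longleftrightarrow> (u, v) \<in> nearby G n"
  unfolding hops_def using assms by (metis LeastI Least_le nearby_mono)

lemma hops_self [simp]: "hops G u u = 0"
  unfolding hops_def by (rule Least_equality) auto

lemma nearby_if_awalk:
  assumes "pair_wf_digraph G" "pre_digraph.awalk (with_proj G) u p v"
  shows "(u, v) \<in> nearby G (length p)"
proof -
  interpret pair_wf_digraph G by fact
  show ?thesis
    using assms(2)
  proof (induction p arbitrary: u)
    case Nil
    then show ?case by (simp add: awalk_Nil_iff)
  next
    case (Cons e es)
    then have "(u, snd e) \<in> (parcs G)\<^sup>=" "(snd e, v) \<in> nearby G (length es)"
      by (auto simp: awalk_Cons_iff)
    then show ?case by (metis length_Cons relpow_Suc_I2)
  qed
qed

text \<open>Only \<open>length p \<le> n\<close> can be had, because the steps that stay put leave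
  no arc in the walk.\<close>

lemma awalk_if_nearby:
  assumes "pair_wf_digraph G" "(u, v) \<in> nearby G n" "u \<in> pverts G"
  shows "\<exists>p. pre_digraph.awalk (with_proj G) u p v \<and> length p \<le> n"
proof -
  interpret pair_wf_digraph G by fact
  show ?thesis
    using assms(2,3)
  proof (induction n arbitrary: u)
    case 0
    then show ?case by (auto simp: awalk_Nil_iff intro!: exI[of _ "[]"])
  next
    case (Suc n)
    then obtain w where w: "(u, w) \<in> (parcs G)\<^sup>=" "(w, v) \<in> nearby G n"
      by (meson relpow_Suc_D2)
    with Suc.prems have "w \<in> pverts G" by (auto dest: in_arcsD2)
    then obtain p where p: "awalk w p v" "length p \<le> n"
      using Suc.IH w by blast
    show ?case
    proof (cases "u = w")
      case True
      then show ?thesis using p le_Suc_eq by blast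
    next
      case False
      then have "awalk u ((u, w) # p) v" using w p by (simp add: awalk_Cons_iff)
      then show ?thesis using p by (intro exI[of _ "(u, w) # p"]) simp
    qed
  qed
qed

lemma gdist_eq_hops:
  assumes "pair_wf_digraph G" "u \<in> pverts G" "(u, v) \<in> nearby G m"
  shows "gdist G u v = ereal (real (hops G u v))"
proof -
  interpret pair_wf_digraph G by fact
  have cost: "awalk_cost (\<lambda>_. 1) p = real (length p)" for p :: "('a \<times> 'a) list"
    by (induction p) auto
  have "(u, v) \<in> nearby G (hops G u v)"
    using hops_le_iff[OF assms(3)] by blast
  then obtain p where p: "awalk u p v" "length p \<le> hops G u v"
    using awalk_if_nearby[OF assms(1) _ assms(2)] by meson
  have "gdist G u v \<le> ereal (real (hops G u v))"
    unfolding gdist_def \<mu>_def using p by (intro INF_lower2[of p]) (auto simp: cost)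
  moreover have "ereal (real (hops G u v)) \<le> gdist G u v"
    unfolding gdist_def \<mu>_def
    using nearby_if_awalk[OF assms(1)] hops_le_iff[OF assms(3)]
    by (intro INF_greatest) (auto simp: cost)
  ultimately show ?thesis by (rule antisym)
qed

text \<open>Connectedness speaks of the symmetric closure, which adds no reachability when the arcs
  are already symmetric.\<close>

lemma connected_nearby:
  assumes "pair_graph G" "Digraph_Component.connected (with_proj G)"
    and "u \<in> pverts G" "v \<in> pverts G"
  obtains n where "(u, v) \<in> nearby G n"
proof -
  interpret pair_graph G by fact
  have "u \<rightarrow>\<^sup>*\<^bsub>with_proj (mk_symmetric G)\<^esub> v"
    using assms(2-4) by (auto simp: connected_def)
  then have "u \<rightarrow>\<^sup>*\<^bsub>with_proj G\<^esub> v"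
    using reachable_mk_symmetric_eq sym_arcs by blast
  then show ?thesis
    using that nearby_if_awalk pair_wf_digraph reachable_awalk by metis
qed

lemma gdist_eq_hops_connected:
  assumes "pair_graph G" "Digraph_Component.connected (with_proj G)"
    and "u \<in> pverts G" "v \<in> pverts G"
  shows "gdist G u v = ereal (real (hops G u v))"
proof -
  interpret pair_graph G by fact
  show ?thesis using connected_nearby[OF assms] gdist_eq_hops assms(3) by (metis pair_wf_digraph)
qed

lemma nearby_sym:
  assumes "pair_graph G"
  shows "(u, v) \<in> nearby G n \<Longrightarrow> (v, u) \<in> nearby G n"
proof (induction n arbitrary: v)
  case (Suc n)
  interpret pair_graph G by fact
  from Suc.prems obtain w where w: "(u, w) \<in> nearby G n" "(w, v) \<in> (parcs G)\<^sup>="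
    by (meson relpow_Suc_E)
  then have "(v, w) \<in> (parcs G)\<^sup>=" by (auto intro: arcs_symmetric)
  then show ?case using Suc.IH w by (metis relpow_Suc_I2)
qed auto

lemma hops_sym: "pair_graph G \<Longrightarrow> hops G u v = hops G v u"
  unfolding hops_def by (metis nearby_sym)

section \<open>Distances along an arc and their parity in bipartite graphs\<close>

lemma hops_step:
  assumes "(s, x) \<in> nearby G m" "(x, y) \<in> parcs G"
  shows "hops G s y \<le> Suc (hops G s x)"
proof -
  have "(s, x) \<in> nearby G (hops G s x)"
    using hops_le_iff[OF assms(1)] by blast
  then have "(s, y) \<in> nearby G (Suc (hops G s x))"
    using assms(2) by (auto intro: relpow_Suc_I)
  then show ?thesis using hops_le_iff by metis
qed

text \<open>Induction on the distance: the vertex before \<open>x\<close> on a shortest walk is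
  exactly one closer to \<open>s\<close> and lies on the other side of the bipartition.\<close>

lemma even_hops:
  assumes AB: "A \<inter> B = {}" "\<forall>(u, v)\<in>parcs G. u \<in> A \<and> v \<in> B \<or> u \<in> B \<and> v \<in> A"
    and "(s, x) \<in> nearby G m"
  shows "even (hops G s x) \<longleftrightarrow> (s \<in> A \<longleftrightarrow> x \<in> A)"
  using assms(3)
proof (induction "hops G s x" arbitrary: x m)
  case 0
  then show ?case using hops_le_iff[OF 0(2), of 0] by simp
next
  case (Suc n)
  have "(s, x) \<in> nearby G (Suc n)"
    using hops_le_iff[OF Suc.prems, of "Suc n"] Suc.hyps(2) by simp
  then obtain w where w: "(s, w) \<in> nearby G n" "(w, x) \<in> (parcs G)\<^sup>="
    by (meson relpow_Suc_E)
  \<comment> \<open>If the last step stayed put, \<open>x\<close> would be at distance at most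
    \<open>n\<close>.\<close>
  have "w \<noteq> x"
    using w(1) hops_le_iff[OF Suc.prems, of n] Suc.hyps(2) by auto
  with w have arc: "(w, x) \<in> parcs G" by simp
  have "hops G s w = n"
    using hops_step[OF w(1) arc] hops_le_iff[OF w(1), of n] w(1) Suc.hyps(2) by simp
  then have "even n \<longleftrightarrow> (s \<in> A \<longleftrightarrow> w \<in> A)"
    using Suc.hyps(1)[of w n] w(1) by simp
  moreover have "w \<in> A \<longleftrightarrow> x \<notin> A" using arc AB by auto
  ultimately show ?case using Suc.hyps(2)[symmetric] by auto
qed

lemma bipartite_hops_neq:
  assumes "bipartite G" "(s, x) \<in> nearby G m" "(x, y) \<in> parcs G"
  shows "hops G s x \<noteq> hops G s y"
proof -
  obtain A B where AB: "A \<inter> B = {}" "\<forall>(u, v)\<in>parcs G. u \<in> A \<and> v \<in> B \<or> u \<in> B \<and> v \<in> A"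
    using assms(1) unfolding bipartite_def by blast
  have "(s, y) \<in> nearby G (Suc m)" using assms(2,3) by (auto intro: relpow_Suc_I)
  from even_hops[OF AB this] even_hops[OF AB assms(2)] show ?thesis
    using AB assms(3) by fastforce
qed

section \<open>True twins and local metric generators\<close>

lemma closed_nbhd_conv: "closed_nbhd G u = {v. (u, v) \<in> (parcs G)\<^sup>=}"
  by (auto simp: closed_nbhd_def)

lemma true_twins_reflcl:
  assumes "pair_graph G" "(x, y) \<in> true_twins G"
  shows "(w, x) \<in> (parcs G)\<^sup>= \<longleftrightarrow> (w, y) \<in> (parcs G)\<^sup>="
proof -
  interpret pair_graph G by fact
  have "(w, z) \<in> (parcs G)\<^sup>= \<longleftrightarrow> w \<in> closed_nbhd G z" for z
    unfolding closed_nbhd_conv by (auto intro: arcs_symmetric)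
  then show ?thesis using assms(2) by (simp add: true_twins_def)
qed

text \<open>The last step into \<open>x\<close> can be redirected to \<open>y\<close> from the same
  vertex. Only for \<open>n = 0\<close> is it needed that \<open>s\<close> is neither twin.\<close>

lemma nearby_true_twins:
  assumes "pair_graph G" "(x, y) \<in> true_twins G" "s \<noteq> x" "s \<noteq> y"
  shows "(s, x) \<in> nearby G n \<longleftrightarrow> (s, y) \<in> nearby G n"
proof (cases n)
  case (Suc k)
  show ?thesis unfolding Suc using true_twins_reflcl[OF assms(1,2)] by (simp add: relcomp_unfold)
qed (use assms in auto)

text \<open>No connectedness is assumed: if one twin is unreachable from \<open>s\<close>, so is the
  other, and both distances are infinite.\<close>

lemma gdist_true_twins:
  assumes "pair_graph G" "(x, y) \<in> true_twins G" "s \<noteq> x" "s \<noteq> y" "s \<in> pverts G"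
  shows "gdist G s x = gdist G s y"
proof -
  interpret pair_graph G by fact
  note iff = nearby_true_twins[OF assms(1-4)]
  show ?thesis
  proof (cases "\<exists>m. (s, x) \<in> nearby G m")
    case True
    then obtain m where "(s, x) \<in> nearby G m" by blast
    moreover from this have "(s, y) \<in> nearby G m" using iff by blast
    moreover have "hops G s x = hops G s y" unfolding hops_def iff ..
    ultimately show ?thesis using gdist_eq_hops[OF pair_wf_digraph assms(5)] by metis
  next
    case False
    then have "\<not> reachable G s x" "\<not> reachable G s y"
      using iff nearby_if_awalk[OF pair_wf_digraph] reachable_awalk by metis+
    then show ?thesis unfolding gdist_def by (simp add: shortest_path_inf)
  qed
qed

text \<open>Distinct true twins are adjacent, so they must be resolved, and no third vertex can do
  it.\<close>

lemma local_metric_generator_true_twins: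
  assumes "pair_graph G" "local_metric_generator G S" "(x, y) \<in> true_twins G" "x \<noteq> y"
  shows "x \<in> S \<or> y \<in> S"
proof (rule ccontr)
  assume *: "\<not> ?thesis"
  have "y \<in> closed_nbhd G x" using assms(3) by (auto simp: true_twins_def closed_nbhd_def)
  with assms(4) have "(x, y) \<in> parcs G" by (auto simp: closed_nbhd_def)
  then obtain s where s: "s \<in> S" "s \<in> pverts G" "gdist G s x \<noteq> gdist G s y"
    using assms(2) unfolding local_metric_generator_def by blast
  with * have "s \<noteq> x" "s \<noteq> y" by auto
  then show False using gdist_true_twins[OF assms(1,3)] s by blast
qed

lemma equiv_true_twins: "equiv (pverts G) (true_twins G)"
  by (rule equivI) (auto simp: true_twins_def refl_on_def sym_def trans_def)

text \<open>Vertices outside \<open>S\<close> lie in pairwise different classes, so there are at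
  most as many of them as classes.\<close>

lemma card_hitting_true_twins:
  assumes "finite (pverts G)" "S \<subseteq> pverts G"
    and "\<And>x y. (x, y) \<in> true_twins G \<Longrightarrow> x \<noteq> y \<Longrightarrow> x \<in> S \<or> y \<in> S"
  shows "card (pverts G) - card (true_twin_classes G) \<le> card S"
proof -
  have "inj_on (\<lambda>x. true_twins G `` {x}) (pverts G - S)"
    using assms(3) eq_equiv_class_iff[OF equiv_true_twins[of G]] by (fastforce intro!: inj_onI)
  moreover have "(\<lambda>x. true_twins G `` {x}) ` (pverts G - S) \<subseteq> true_twin_classes G"
    unfolding true_twin_classes_def by (auto intro: quotientI)
  moreover have "finite (true_twin_classes G)"
    unfolding true_twin_classes_def using assms(1) by (auto simp: quotient_def)
  ultimately have "card (pverts G - S) \<le> card (true_twin_classes G)"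
    by (rule card_inj_on_le)
  then show ?thesis
    using card_Diff_subset[OF finite_subset[OF assms(2,1)] assms(2)] by linarith
qed

text \<open>Each arc is resolved by its own tail. This makes the minimum in
  \<open>local_metric_dim\<close> range over a nonempty set.\<close>

lemma local_metric_generator_pverts:
  assumes "pair_graph G"
  shows "local_metric_generator G (pverts G)"
  unfolding local_metric_generator_def
proof safe
  interpret pair_graph G by fact
  fix x y assume xy: "(x, y) \<in> parcs G"
  then have "x \<noteq> y" "x \<in> pverts G" by (auto dest: no_loops' in_arcsD1)
  have x: "(x, x) \<in> nearby G 0" and y: "(x, y) \<in> nearby G 1" using xy by auto
  have "hops G x y \<noteq> 0" using hops_le_iff[OF y, of 0] \<open>x \<noteq> y\<close> by auto
  then show "\<exists>s\<in>pverts G. gdist G s x \<noteq> gdist G s y"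
    using gdist_eq_hops[OF pair_wf_digraph \<open>x \<in> pverts G\<close> x]
      gdist_eq_hops[OF pair_wf_digraph \<open>x \<in> pverts G\<close> y] \<open>x \<in> pverts G\<close>
    by (intro bexI[of _ x]) auto
qed

lemma local_metric_basis_exists:
  assumes "pair_graph G"
  obtains W where "local_metric_generator G W" "card W = local_metric_dim G"
  using LeastI_ex[of "\<lambda>k. \<exists>S. local_metric_generator G S \<and> card S = k"]
    local_metric_generator_pverts[OF assms] unfolding local_metric_dim_def by blast

lemma connected_arc_exists:
  assumes "pair_graph G" "Digraph_Component.connected (with_proj G)" "card (pverts G) \<ge> 2"
  shows "parcs G \<noteq> {}"
proof
  assume empty: "parcs G = {}"
  have "nearby G n \<subseteq> Id" for n by (induction n) (auto simp: empty)
  then have "u = v" if "u \<in> pverts G" "v \<in> pverts G" for u v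
    using connected_nearby[OF assms(1,2) that] by blast
  then have "card (pverts G) \<le> 1" by (metis card_le_Suc0_iff_eq card.infinite One_nat_def le0)
  with assms(3) show False by simp
qed

section \<open>The strong product\<close>

lemma pverts_strong_product [simp]: "pverts (G \<boxtimes> H) = pverts G \<times> pverts H"
  by (simp add: strong_product_def)

text \<open>Allowing a step to stay put merges the three kinds of adjacency into one condition per
  coordinate.\<close>

lemma reflcl_strong_product:
  assumes "pair_graph G" "pair_graph H" "a \<in> pverts G" "b \<in> pverts H"
  shows "((a, b), (c, d)) \<in> (parcs (G \<boxtimes> H))\<^sup>= \<longleftrightarrow> (a, c) \<in> (parcs G)\<^sup>= \<and> (b, d) \<in> (parcs H)\<^sup>="
proof -
  interpret G: pair_graph G by fact
  interpret H: pair_graph H by fact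
  show ?thesis
    using assms(3,4) by (auto simp: strong_product_def dest: G.in_arcsD2 H.in_arcsD2)
qed

lemma nearby_strong_product:
  assumes "pair_graph G" "pair_graph H" "a \<in> pverts G" "b \<in> pverts H"
  shows "((a, b), (c, d)) \<in> nearby (G \<boxtimes> H) n \<longleftrightarrow> (a, c) \<in> nearby G n \<and> (b, d) \<in> nearby H n"
  using assms(3,4)
proof (induction n arbitrary: a b)
  case 0
  then show ?case by auto
next
  case (Suc n)
  interpret G: pair_graph G by fact
  interpret H: pair_graph H by fact
  have step: "p \<in> pverts G \<and> q \<in> pverts H"
    if "(a, p) \<in> (parcs G)\<^sup>=" "(b, q) \<in> (parcs H)\<^sup>=" for p q
    using that Suc.prems by (auto dest: G.in_arcsD2 H.in_arcsD2)
  have "((a, b), (c, d)) \<in> nearby (G \<boxtimes> H) (Suc n) \<longleftrightarrow>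
      (\<exists>p q. ((a, b), (p, q)) \<in> (parcs (G \<boxtimes> H))\<^sup>= \<and> ((p, q), (c, d)) \<in> nearby (G \<boxtimes> H) n)"
    unfolding nearby_Suc_iff by force
  also have "\<dots> \<longleftrightarrow> (\<exists>p q. ((a, p) \<in> (parcs G)\<^sup>= \<and> (b, q) \<in> (parcs H)\<^sup>=) \<and>
      (p, c) \<in> nearby G n \<and> (q, d) \<in> nearby H n)"
    unfolding reflcl_strong_product[OF assms(1,2) Suc.prems] using step Suc.IH by blast
  also have "\<dots> \<longleftrightarrow> (a, c) \<in> nearby G (Suc n) \<and> (b, d) \<in> nearby H (Suc n)"
    unfolding nearby_Suc_iff by blast
  finally show ?case .
qed

text \<open>Balls in the product are products of balls of the same radius, so the distance is the
  maximum of the two coordinate distances.\<close>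

lemma gdist_strong_product:
  assumes "pair_graph G" "Digraph_Component.connected (with_proj G)"
    and "pair_graph H" "Digraph_Component.connected (with_proj H)"
    and "a \<in> pverts G" "b \<in> pverts H" "c \<in> pverts G" "d \<in> pverts H"
  shows "gdist (G \<boxtimes> H) (a, b) (c, d) = ereal (real (max (hops G a c) (hops H b d)))"
proof -
  interpret GH: pair_graph "G \<boxtimes> H" using assms(1,3) by (rule pair_graph_strong_product)
  obtain m where m: "(a, c) \<in> nearby G m" using connected_nearby[OF assms(1,2,5,7)] .
  obtain k where k: "(b, d) \<in> nearby H k" using connected_nearby[OF assms(3,4,6,8)] .
  note prod = nearby_strong_product[OF assms(1,3,5,6)]
  have near: "((a, b), (c, d)) \<in> nearby (G \<boxtimes> H) (max m k)"
    unfolding prod using m k by (auto intro: nearby_mono)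
  have "hops (G \<boxtimes> H) (a, b) (c, d) \<le> n \<longleftrightarrow> max (hops G a c) (hops H b d) \<le> n" for n
    unfolding hops_le_iff[OF near] prod using hops_le_iff[OF m] hops_le_iff[OF k] by simp
  then have "hops (G \<boxtimes> H) (a, b) (c, d) = max (hops G a c) (hops H b d)"
    by (meson antisym order_refl)
  then show ?thesis
    using gdist_eq_hops[OF GH.pair_wf_digraph _ near] assms(5,6) by simp
qed

section \<open>The lower bound, counted copy by copy\<close>

lemma true_twins_strong_product:
  assumes "pair_graph G" "pair_graph H" "(x, y) \<in> true_twins G" "h \<in> pverts H"
  shows "((x, h), (y, h)) \<in> true_twins (G \<boxtimes> H)"
proof -
  have v: "x \<in> pverts G" "y \<in> pverts G" using assms(3) by (auto simp: true_twins_def)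
  have nbhd: "closed_nbhd (G \<boxtimes> H) (z, h) = closed_nbhd G z \<times> closed_nbhd H h"
    if "z \<in> pverts G" for z
    unfolding closed_nbhd_conv using reflcl_strong_product[OF assms(1,2) that assms(4)]
    by (simp only: set_eq_iff split_paired_All mem_Times_iff mem_Collect_eq fst_conv snd_conv) simp
  show ?thesis
    using assms(3,4) v nbhd by (auto simp: true_twins_def)
qed

lemma card_local_metric_generator_strong_product:
  assumes "pair_graph G" "pair_graph H" "local_metric_generator (G \<boxtimes> H) S"
  shows "card (pverts H) * (card (pverts G) - card (true_twin_classes G)) \<le> card S"
proof -
  interpret G: pair_graph G by fact
  interpret H: pair_graph H by fact
  have GH: "pair_graph (G \<boxtimes> H)" using assms(1,2) by (rule pair_graph_strong_product)
  define layer where "layer h = {a. (a, h) \<in> S}" for h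
  have S: "S \<subseteq> pverts G \<times> pverts H"
    using assms(3) by (simp add: local_metric_generator_def)
  have le: "card (pverts G) - card (true_twin_classes G) \<le> card (layer h)" if "h \<in> pverts H" for h
  proof (rule card_hitting_true_twins)
    show "layer h \<subseteq> pverts G" using S by (auto simp: layer_def)
    show "x \<in> layer h \<or> y \<in> layer h" if "(x, y) \<in> true_twins G" "x \<noteq> y" for x y
      using local_metric_generator_true_twins[OF GH assms(3)
          true_twins_strong_product[OF assms(1,2) that(1) \<open>h \<in> pverts H\<close>]] that(2)
      by (auto simp: layer_def)
  qed simp
  have fin: "finite (layer h)" for h
    using S by (intro finite_subset[OF _ G.pair_finite_verts]) (auto simp: layer_def)
  \<comment> \<open>The layers are indexed by the second coordinate, but \<open>SIGMA\<close> puts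
    the index first.\<close>
  have "S = prod.swap ` (SIGMA h:pverts H. layer h)"
    using S by (force simp: layer_def)
  then have "card S = (\<Sum>h\<in>pverts H. card (layer h))"
    using fin by (simp add: card_image card_SigmaI)
  also have "\<dots> \<ge> card (pverts H) * (card (pverts G) - card (true_twin_classes G))"
    using sum_bounded_below[of "pverts H" _ "\<lambda>h. card (layer h)"] le by fastforce
  finally show ?thesis .
qed

section \<open>The upper bound\<close>

text \<open>Every eccentricity in \<open>H\<close> is at least the radius, so the supremum defining
  that of \<open>b\<close> exceeds \<open>diameter G\<close> at some \<open>h\<close>.\<close>

lemma hops_gt_diameter:
  assumes "pair_graph G" "Digraph_Component.connected (with_proj G)"
    and "pair_graph H" "Digraph_Component.connected (with_proj H)"
    and "diameter G < radius H" "b \<in> pverts H"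
  obtains h where "h \<in> pverts H"
    and "\<And>u v. u \<in> pverts G \<Longrightarrow> v \<in> pverts G \<Longrightarrow> hops G u v < hops H h b"
proof -
  have "radius H \<le> eccentricity H b"
    unfolding radius_def using assms(6) by (rule INF_lower)
  with assms(5) obtain h where h: "h \<in> pverts H" "diameter G < gdist H b h"
    unfolding eccentricity_def by (meson less_SUP_iff less_le_trans)
  have "hops G u v < hops H h b" if "u \<in> pverts G" "v \<in> pverts G" for u v
  proof -
    have "gdist G u v \<le> diameter G"
      unfolding diameter_def eccentricity_def using that by (blast intro: SUP_upper2)
    with h(2) have "gdist G u v < gdist H b h" by simp
    then show ?thesis
      using gdist_eq_hops_connected[OF assms(1,2) that]
        gdist_eq_hops_connected[OF assms(3,4,6) h(1)] hops_sym[OF assms(3)] by simp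
  qed
  then show ?thesis using that h(1) by blast
qed

lemma local_metric_generator_strong_product:
  assumes G: "pair_graph G" "Digraph_Component.connected (with_proj G)"
    and H: "pair_graph H" "Digraph_Component.connected (with_proj H)" "bipartite H"
    and "diameter G < radius H"
    and W: "local_metric_generator G W" "W \<noteq> {}"
  shows "local_metric_generator (G \<boxtimes> H) (W \<times> pverts H)"
proof -
  interpret H: pair_graph H by fact
  have WV: "W \<subseteq> pverts G" using W(1) by (simp add: local_metric_generator_def)
  note dist = gdist_strong_product[OF G H(1,2)]
  have "\<exists>s\<in>W \<times> pverts H. gdist (G \<boxtimes> H) s (a, b) \<noteq> gdist (G \<boxtimes> H) s (c, d)"
    if arc: "((a, b), (c, d)) \<in> parcs (G \<boxtimes> H)" for a b c d
  proof -
    have v: "a \<in> pverts G" "b \<in> pverts H" "c \<in> pverts G" "d \<in> pverts H"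
      using arc by (auto simp: strong_product_def)
    show ?thesis
    proof (cases "b = d")
      case True
      then have "(a, c) \<in> parcs G" using arc by (auto simp: strong_product_def dest: H.no_loops')
      then obtain w where w: "w \<in> W" "gdist G w a \<noteq> gdist G w c"
        using W(1) unfolding local_metric_generator_def by blast
      then have "w \<in> pverts G" using WV by blast
      then have "hops G w a \<noteq> hops G w c"
        using w(2) gdist_eq_hops_connected[OF G] v by metis
      then have "gdist (G \<boxtimes> H) (w, b) (a, b) \<noteq> gdist (G \<boxtimes> H) (w, b) (c, d)"
        using True v \<open>w \<in> pverts G\<close> by (simp add: dist)
      then show ?thesis using w(1) v(2) by blast
    next
      case False
      then have bd: "(b, d) \<in> parcs H" using arc by (auto simp: strong_product_def)
      obtain w where w: "w \<in> W" "w \<in> pverts G" using W(2) WV by blast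
      obtain h where h: "h \<in> pverts H"
        and far: "\<And>u v. u \<in> pverts G \<Longrightarrow> v \<in> pverts G \<Longrightarrow> hops G u v < hops H h b"
        using hops_gt_diameter[OF G H(1,2) assms(6) v(2)] by blast
      obtain m where m: "(h, b) \<in> nearby H m" using connected_nearby[OF H(1,2) h v(2)] .
      obtain k where k: "(h, d) \<in> nearby H k" using connected_nearby[OF H(1,2) h v(4)] .
      have "hops H h b \<le> Suc (hops H h d)"
        using hops_step[OF k] bd H.arcs_symmetric by blast
      moreover have "hops H h b \<noteq> hops H h d"
        using bipartite_hops_neq[OF H(3) m bd] .
      \<comment> \<open>Passing from \<open>b\<close> to \<open>d\<close> loses at most one, and the
        strict inequality in \<open>far\<close> absorbs this: the second coordinate still attains
        the maximum.\<close>
      ultimately have "max (hops G w a) (hops H h b) \<noteq> max (hops G w c) (hops H h d)"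
        using far[OF w(2) v(1)] far[OF w(2) v(3)] by linarith
      then have "gdist (G \<boxtimes> H) (w, h) (a, b) \<noteq> gdist (G \<boxtimes> H) (w, h) (c, d)"
        using v w(2) h by (simp add: dist del: of_nat_max)
      then show ?thesis using w(1) h by blast
    qed
  qed
  then show ?thesis
    using WV unfolding local_metric_generator_def by auto
qed

theorem theorem14:
  fixes G :: "'a pair_pre_digraph" and H :: "'b pair_pre_digraph"
    and n\<^sub>1 n\<^sub>2 t\<^sub>1 :: nat
  assumes "pair_graph H" and "Digraph_Component.connected (with_proj H)" and "bipartite H"
    and "card (pverts H) = n\<^sub>2"
    and "pair_graph G" and "Digraph_Component.connected (with_proj G)"
    and "card (pverts G) = n\<^sub>1" and "n\<^sub>1 \<ge> 2"
    and "card (true_twin_classes G) = t\<^sub>1"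
    and "local_metric_dim G = n\<^sub>1 - t\<^sub>1"
    and "diameter G < radius H"
  shows "local_metric_dim (G \<boxtimes> H) = n\<^sub>2 * (n\<^sub>1 - t\<^sub>1)"
proof -
  obtain W where W: "local_metric_generator G W" "card W = n\<^sub>1 - t\<^sub>1"
    using local_metric_basis_exists[OF assms(5)] assms(10) by metis
  \<comment> \<open>An arc forces \<open>W\<close> to be nonempty, which supplies the first
    coordinate of a resolving vertex for pairs in different copies of \<open>G\<close>.\<close>
  have "parcs G \<noteq> {}" using connected_arc_exists assms(5-8) by blast
  then have "W \<noteq> {}" using W(1) by (auto simp: local_metric_generator_def)
  then have "local_metric_generator (G \<boxtimes> H) (W \<times> pverts H)"
    using local_metric_generator_strong_product assms(1-3,5,6,11) W(1) by blast
  moreover have "card (W \<times> pverts H) = n\<^sub>2 * (n\<^sub>1 - t\<^sub>1)"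
    using W(2) assms(4) by (simp add: card_cartesian_product)
  ultimately show ?thesis
    unfolding local_metric_dim_def
    using card_local_metric_generator_strong_product[OF assms(5,1)] assms(4,7,9)
    by (intro Least_equality) auto
qed

end
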